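(* Let $1\le n<N$ be integers, $\lambda\in(0,1]$, and $\bar G=\max_{k,l,a,b}G_{k,l}(a,b)$. Let $v_N(p,q)$ be the value of the $N$-stage $\lambda$-discounted primal game $\Gamma_{N,\lambda}(p,q)$. If player 2 plays a window-by-window strategy $\tau^\star$ with window size $n$, then its worst case performance satisfies $$J_N^{\tau^\star}(p,q)-v_N(p,q)\le\lambda^n\,\frac{1-\lambda^{N-n}}{1-\lambda}\,\bar G .$$ If player 1 plays a window-by-window strategy $\sigma^\star$ with window size $n$, then its worst case performance satisfies $$v_N(p,q)-J_N^{\sigma^\star}(p,q)\le\lambda^n\,\frac{1-\lambda^{N-n}}{1-\lambda}\,\bar G .$$ (For $\lambda=1$ the fraction is read as $\sum_{i=0}^{N-n-1}\lambda^i=N-n$.)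
   Context: Game. $\mathcal K,\mathcal L$ (states of players 1, 2) and $\mathcal A,\mathcal B$ (actions of players 1, 2) are non-empty finite sets. $G_{k,l}\in\mathbb R^{|\mathcal A|\times|\mathcal B|}$ has non-negative entries $G_{k,l}(a,b)$ (payoff to player 1, cost to player 2). $p\in\Delta(\mathcal K)$, $q\in\Delta(\mathcal L)$ are initial distributions. For each $(a,b)$, $P_{a,b}(k,k')$ and $Q_{a,b}(l,l')$ are transition probabilities (row-stochastic). At stage 1, $k_1\sim p$ and $l_1\sim q$ are drawn independently; for $t\ge2$, $k_t$ and $l_t$ are drawn independently according to $P_{a_{t-1},b_{t-1}}(k_{t-1},\cdot)$ and $Q_{a_{t-1},b_{t-1}}(l_{t-1},\cdot)$. Player 1 sees only the states $k_t$, player 2 only the states $l_t$. At every stage the players choose $a_t,b_t$ simultaneously and both then observe $(a_t,b_t)$; payoffs are not observed during play. With $\mathcal I_t=(k_1,a_1,b_1,\dots,k_{t-1},a_{t-1},b_{t-1},k_t)$ and $\mathcal J_t=(l_1,a_1,b_1,\dots,l_{t-1},a_{t-1},b_{t-1},l_t)$, behavior strategies are $\sigma=(\sigma_t)$, $\tau=(\tau_t)$ with $\sigma_t(\mathcal I_t)\in\Delta(\mathcal A)$, $\tau_t(\mathcal J_t)\in\Delta(\mathcal B)$. The payoff of the primal game $\Gamma_{N,\lambda}(p,q)$ is $E_{p,q,\sigma,\tau}\big(\sum_{t=1}^N\lambda^{t-1}G_{k_t,l_t}(a_t,b_t)\big)$, maximized by player 1 and minimized by player 2; its value is $v_N(p,q)=\max_\sigma\min_\tau=\min_\tau\max_\sigma$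 of the payoff, and a security (optimal) strategy attains the outer optimum. Worst case performance. $J_N^\sigma(p,q)=\min_\tau E_{p,q,\sigma,\tau}\big(\sum_{t=1}^N\lambda^{t-1}G_{k_t,l_t}(a_t,b_t)\big)$ and $J_N^\tau(p,q)=\max_\sigma E_{p,q,\sigma,\tau}\big(\sum_{t=1}^N\lambda^{t-1}G_{k_t,l_t}(a_t,b_t)\big)$. Dual games. The type 1 dual game $\tilde\Gamma^1_{m,\lambda}(\mu,q)$, $\mu\in\mathbb R^{|\mathcal K|}$, is the $m$-stage game played as the primal game except that player 1 itself chooses the distribution $p$ of its initial state (unobserved by player 2), with payoff $E(\mu(k_1)+\sum_{t=1}^m\lambda^{t-1}G_{k_t,l_t}(a_t,b_t))$ and value $w^1_{m,\lambda}(\mu,q)$. The type 2 dual game $\tilde\Gamma^2_{m,\lambda}(p,\nu)$, $\nu\in\mathbb R^{|\mathcal L|}$, is the one where player 2 itself chooses the distribution $q$ of its initial state (unobserved by player 1), with payoff $E(\nu(l_1)+\sum_{t=1}^m\lambda^{t-1}G_{k_t,l_t}(a_t,b_t))$ and value $w^2_{m,\lambda}(p,\nu)$. With zero stages, $w^1_{0,\lambda}(\mu,q)=\max_k\mu(k)$ and $w^2_{0,\lambda}(p,\nu)=\min_l\nu(l)$. Updates. For $X(\cdot,k)\in\Delta(\mathcal A)$, $Y(\cdot,l)\in\Delta(\mathcal B)$ let $\bar x_{p,X}(a)=\sum_kp(k)X(a,k)$, $\bar y_{q,Y}(b)=\sum_lq(l)Y(b,l)$ and, after the action pair $(a,b)$,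 $p^+_{p,X}(k')=\sum_kP_{a,b}(k,k')p(k)X(a,k)/\bar x_{p,X}(a)$, $q^+_{q,Y}(l')=\sum_lQ_{a,b}(l,l')q(l)Y(b,l)/\bar y_{q,Y}(b)$ (arbitrary probability vectors if the denominator vanishes). Window-by-window strategy $\sigma^\star$ of player 1, window size $n$. (1) Stages $1,\dots,n$ (first window): play an optimal (security) strategy $\sigma^*$ of player 1 in the $n$-stage primal game $\Gamma_{n,\lambda}(p,q)$. Set $p_1=p$ and $\nu_1=-\alpha(\sigma^* )$, where $\alpha_l(\sigma)=\min_\tau E_{p,q,\sigma,\tau}(\sum_{t=1}^n\lambda^{t-1}G_{k_t,l_t}(a_t,b_t)\mid l_1=l)$. (2) After each stage $t$, with observed actions $(a_t,b_t)$, set $p_{t+1}=p^+_{p_t,X}$, where $X(a,k)$ is the probability with which player 1's stage-$t$ strategy selects $a$ given current state $k$, and $\nu_{t+1}=\alpha^*_{a_t,b_t}$, where $\alpha^*=(\alpha^*_{a,b})$ is the $\alpha$-part of an optimal solution of $$w^2_{n,\lambda}(p_t,\nu_t)=\max_X\max_{(\alpha_{a,b})}\min_{\Psi\in\Delta(\mathcal B\times\mathcal L)}\sum_{b,l}\Psi(b,l)\Big[\nu_t(l)+\sum_{k,a}G_{k,l}(a,b)X(a,k)p_t(k)+\lambda\sum_a\bar x_{p_t,X}(a)\Big(w^2_{n-1,\lambda}(p^+_{p_t,X},\alpha_{a,b})-\sum_{l'}Q_{a,b}(l,l')\alpha_{a,b}(l')\Big)\Big].$$ (3) At the first stage $t$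 of each later window (windows of $n$ consecutive stages; the last window consists of the remaining $m\le n$ stages), compute an optimal strategy of player 1 in the type 2 dual game $\tilde\Gamma^2_{n,\lambda}(p_t,\nu_t)$ (with $m$ in place of $n$ for a shorter last window) and play it throughout the window. Window-by-window strategy $\tau^\star$ of player 2, symmetrically: in the first window play an optimal (security) strategy $\tau^*$ of player 2 in $\Gamma_{n,\lambda}(p,q)$; set $q_1=q$, $\mu_1=-\beta(\tau^* )$ with $\beta_k(\tau)=\max_\sigma E_{p,q,\sigma,\tau}(\sum_{t=1}^n\lambda^{t-1}G_{k_t,l_t}(a_t,b_t)\mid k_1=k)$; after each stage set $q_{t+1}=q^+_{q_t,Y}$ ($Y(b,l)$ the probability with which player 2's stage-$t$ strategy selects $b$ given current state $l$) and $\mu_{t+1}=\beta^*_{a_t,b_t}$, where $\beta^*$ is the $\beta$-part of an optimal solution of $$w^1_{n,\lambda}(\mu_t,q_t)=\min_Y\min_{(\beta_{a,b})}\max_{\Pi\in\Delta(\mathcal A\times\mathcal K)}\sum_{a,k}\Pi(a,k)\Big[\mu_t(k)+\sum_{l,b}G_{k,l}(a,b)Y(b,l)q_t(l)+\lambda\sum_b\bar y_{q_t,Y}(b)\Big(w^1_{n-1,\lambda}(\beta_{a,b},q^+_{q_t,Y})-\sum_{k'}P_{a,b}(k,k')\beta_{a,b}(k')\Big)\Big];$$ and in each later window play an optimal strategy of player 2 in the type 1 dual game $\tilde\Gamma^1_{n,\lambda}(\mu_t,q_t)$ (horizon $m$ for a shorter last window), with $t$ the first stage of the window. *)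

theory Defs
  imports "HOL-Probability.Probability"
begin

(* Distributions over finite sets are rendered by pmf over types of class finite.
   Transitions are indexed by the action pair: trans1 \<Gamma> (a, b) k is P_{a,b}(k, .). *)

record ('k, 'l, 'a, 'b) game =
  pay :: "'k \<Rightarrow> 'l \<Rightarrow> 'a \<Rightarrow> 'b \<Rightarrow> real"
  trans1 :: "'a \<times> 'b \<Rightarrow> 'k \<Rightarrow> 'k pmf"
  trans2 :: "'a \<times> 'b \<Rightarrow> 'l \<Rightarrow> 'l pmf"
  disc :: real

(* All histories are lists with the most recent stage FIRST.  A behavior strategy receives the
   player's own past (own state and action pair of each past stage) and the current own state.
   In an m-stage game only its values on histories of length < m matter. *)

type_synonym ('s, 'x, 'c) strategy = "('s \<times> 'x) list \<Rightarrow> 's \<Rightarrow> 'c pmf"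
type_synonym ('k, 'a, 'b) strategy1 = "('k, 'a \<times> 'b, 'a) strategy"
type_synonym ('l, 'a, 'b) strategy2 = "('l, 'a \<times> 'b, 'b) strategy"

definition view1 :: "('k \<times> 'l \<times> 'a \<times> 'b) list \<Rightarrow> ('k \<times> 'a \<times> 'b) list" where
  "view1 = map (\<lambda>(k, l, x). (k, x))"

definition view2 :: "('k \<times> 'l \<times> 'a \<times> 'b) list \<Rightarrow> ('l \<times> 'a \<times> 'b) list" where
  "view2 = map (\<lambda>(k, l, x). (l, x))"

(* Law of (record of stages 1..m, k_{m+1}, l_{m+1}). *)

primrec play :: "('k, 'l, 'a, 'b) game \<Rightarrow> 'k pmf \<Rightarrow> 'l pmf \<Rightarrow>
    ('k, 'a, 'b) strategy1 \<Rightarrow> ('l, 'a, 'b) strategy2 \<Rightarrow> nat \<Rightarrow>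
    (('k \<times> 'l \<times> 'a \<times> 'b) list \<times> 'k \<times> 'l) pmf" where
  "play \<Gamma> p q \<sigma> \<tau> 0 = map_pmf (\<lambda>(k, l). ([], k, l)) (pair_pmf p q)"
| "play \<Gamma> p q \<sigma> \<tau> (Suc m) =
     bind_pmf (play \<Gamma> p q \<sigma> \<tau> m) (\<lambda>(h, k, l).
     bind_pmf (pair_pmf (\<sigma> (view1 h) k) (\<tau> (view2 h) l)) (\<lambda>(a, b).
     bind_pmf (pair_pmf (trans1 \<Gamma> (a, b) k) (trans2 \<Gamma> (a, b) l)) (\<lambda>(k', l').
     return_pmf ((k, l, a, b) # h, k', l'))))"

fun initial :: "('k \<times> 'l \<times> 'a \<times> 'b) list \<times> 'k \<times> 'l \<Rightarrow> 'k \<times> 'l" where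
  "initial (h, k, l) = (if h = [] then (k, l) else (case last h of (k1, l1, _) \<Rightarrow> (k1, l1)))"

definition total_pay :: "('k, 'l, 'a, 'b) game \<Rightarrow> ('k \<times> 'l \<times> 'a \<times> 'b) list \<Rightarrow> real" where
  "total_pay \<Gamma> h =
     (\<Sum>t<length h. disc \<Gamma> ^ t * (case rev h ! t of (k, l, a, b) \<Rightarrow> pay \<Gamma> k l a b))"

definition payoff :: "('k, 'l, 'a, 'b) game \<Rightarrow> nat \<Rightarrow> 'k pmf \<Rightarrow> 'l pmf \<Rightarrow>
    ('k, 'a, 'b) strategy1 \<Rightarrow> ('l, 'a, 'b) strategy2 \<Rightarrow> real" where
  "payoff \<Gamma> m p q \<sigma> \<tau> =
     measure_pmf.expectation (play \<Gamma> p q \<sigma> \<tau> m) (\<lambda>z. total_pay \<Gamma> (fst z))"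

(* In the dual games the player who chooses his initial distribution has strategies that are
   pairs of a distribution and a behavior strategy. *)

definition dual_payoff1 :: "('k, 'l, 'a, 'b) game \<Rightarrow> nat \<Rightarrow> ('k \<Rightarrow> real) \<Rightarrow> 'l pmf \<Rightarrow>
    'k pmf \<times> ('k, 'a, 'b) strategy1 \<Rightarrow> ('l, 'a, 'b) strategy2 \<Rightarrow> real" where
  "dual_payoff1 \<Gamma> m \<mu> q = (\<lambda>(p, \<sigma>) \<tau>.
     measure_pmf.expectation (play \<Gamma> p q \<sigma> \<tau> m)
       (\<lambda>z. \<mu> (fst (initial z)) + total_pay \<Gamma> (fst z)))"

definition dual_payoff2 :: "('k, 'l, 'a, 'b) game \<Rightarrow> nat \<Rightarrow> 'k pmf \<Rightarrow> ('l \<Rightarrow> real) \<Rightarrow>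
    ('k, 'a, 'b) strategy1 \<Rightarrow> 'l pmf \<times> ('l, 'a, 'b) strategy2 \<Rightarrow> real" where
  "dual_payoff2 \<Gamma> m p \<nu> = (\<lambda>\<sigma> (q, \<tau>).
     measure_pmf.expectation (play \<Gamma> p q \<sigma> \<tau> m)
       (\<lambda>z. \<nu> (snd (initial z)) + total_pay \<Gamma> (fst z)))"

(* Zero-sum games in normal form; the first player maximizes. *)

definition game_value :: "('s \<Rightarrow> 't \<Rightarrow> real) \<Rightarrow> real" where
  "game_value u = (SUP s. INF t. u s t)"

definition optimal_max :: "('s \<Rightarrow> 't \<Rightarrow> real) \<Rightarrow> 's \<Rightarrow> bool" where
  "optimal_max u s \<longleftrightarrow> (\<forall>s'. (INF t. u s' t) \<le> (INF t. u s t))"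

definition optimal_min :: "('s \<Rightarrow> 't \<Rightarrow> real) \<Rightarrow> 't \<Rightarrow> bool" where
  "optimal_min u t \<longleftrightarrow> (\<forall>t'. (SUP s. u s t) \<le> (SUP s. u s t'))"

definition primal_value :: "('k, 'l, 'a, 'b) game \<Rightarrow> nat \<Rightarrow> 'k pmf \<Rightarrow> 'l pmf \<Rightarrow> real" where
  "primal_value \<Gamma> m p q = game_value (payoff \<Gamma> m p q)"

definition dual_value1 :: "('k, 'l, 'a, 'b) game \<Rightarrow> nat \<Rightarrow> ('k \<Rightarrow> real) \<Rightarrow> 'l pmf \<Rightarrow> real" where
  "dual_value1 \<Gamma> m \<mu> q = game_value (dual_payoff1 \<Gamma> m \<mu> q)"

definition dual_value2 :: "('k, 'l, 'a, 'b) game \<Rightarrow> nat \<Rightarrow> 'k pmf \<Rightarrow> ('l \<Rightarrow> real) \<Rightarrow> real" where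
  "dual_value2 \<Gamma> m p \<nu> = game_value (dual_payoff2 \<Gamma> m p \<nu>)"

lemma initial_Nil: "initial ([], z) = z"
  by (cases z) simp

lemma dual_payoff1_0: "dual_payoff1 \<Gamma> 0 \<mu> q (p, \<sigma>) \<tau> = measure_pmf.expectation p \<mu>"
proof -
  have "dual_payoff1 \<Gamma> 0 \<mu> q (p, \<sigma>) \<tau>
      = measure_pmf.expectation (pair_pmf p q) (\<lambda>z. \<mu> (fst z))"
    by (simp add: dual_payoff1_def total_pay_def case_prod_beta initial_Nil)
  also have "\<dots> = measure_pmf.expectation (map_pmf fst (pair_pmf p q)) \<mu>"
    by (simp only: integral_map_pmf)
  finally show ?thesis by (simp add: map_fst_pair_pmf)
qed

lemma dual_payoff2_0: "dual_payoff2 \<Gamma> 0 p \<nu> \<sigma> (q, \<tau>) = measure_pmf.expectation q \<nu>"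
proof -
  have "dual_payoff2 \<Gamma> 0 p \<nu> \<sigma> (q, \<tau>)
      = measure_pmf.expectation (pair_pmf p q) (\<lambda>z. \<nu> (snd z))"
    by (simp add: dual_payoff2_def total_pay_def case_prod_beta initial_Nil)
  also have "\<dots> = measure_pmf.expectation (map_pmf snd (pair_pmf p q)) \<nu>"
    by (simp only: integral_map_pmf)
  finally show ?thesis by (simp add: map_snd_pair_pmf)
qed

lemma expectation_le_Max:
  fixes f :: "'s::finite \<Rightarrow> real"
  shows "measure_pmf.expectation p f \<le> Max (range f)"
proof -
  have "measure_pmf.expectation p f \<le> measure_pmf.expectation p (\<lambda>_. Max (range f))"
    by (intro integral_mono integrable_measure_pmf_finite) auto
  then show ?thesis by simp
qed

lemma Min_le_expectation:
  fixes f :: "'s::finite \<Rightarrow> real"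
  shows "Min (range f) \<le> measure_pmf.expectation p f"
proof -
  have "measure_pmf.expectation p (\<lambda>_. Min (range f)) \<le> measure_pmf.expectation p f"
    by (intro integral_mono integrable_measure_pmf_finite) auto
  then show ?thesis by simp
qed

lemma dual_value1_0:
  fixes \<Gamma> :: "('k::finite, 'l, 'a, 'b) game"
  shows "dual_value1 \<Gamma> 0 \<mu> q = Max (range \<mu>)"
proof -
  let ?u = "\<lambda>s :: 'k pmf \<times> ('k, 'a, 'b) strategy1. measure_pmf.expectation (fst s) \<mu>"
  have "dual_value1 \<Gamma> 0 \<mu> q = (SUP s. ?u s)"
    by (auto simp: dual_value1_def game_value_def dual_payoff1_0 intro!: SUP_cong)
  also have "\<dots> = Max (range \<mu>)"
  proof (rule antisym)
    show "(SUP s. ?u s) \<le> Max (range \<mu>)"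
      by (intro cSUP_least expectation_le_Max) auto
    have "Max (range \<mu>) \<in> range \<mu>" by (intro Max_in) auto
    then obtain k where "Max (range \<mu>) = \<mu> k" by blast
    then have "Max (range \<mu>) = ?u (return_pmf k, undefined)" by simp
    also have "\<dots> \<le> (SUP s. ?u s)"
      by (rule cSUP_upper) (auto intro!: bdd_aboveI[of _ "Max (range \<mu>)"] expectation_le_Max)
    finally show "Max (range \<mu>) \<le> (SUP s. ?u s)" .
  qed
  finally show ?thesis .
qed

lemma dual_value2_0:
  fixes \<Gamma> :: "('k, 'l::finite, 'a, 'b) game"
  shows "dual_value2 \<Gamma> 0 p \<nu> = Min (range \<nu>)"
proof -
  let ?u = "\<lambda>t :: 'l pmf \<times> ('l, 'a, 'b) strategy2. measure_pmf.expectation (fst t) \<nu>"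
  have "dual_payoff2 \<Gamma> 0 p \<nu> \<sigma> t = ?u t" for \<sigma> t
    by (cases t) (simp add: dual_payoff2_0)
  then have "dual_value2 \<Gamma> 0 p \<nu> = (INF t. ?u t)"
    by (simp add: dual_value2_def game_value_def)
  also have "\<dots> = Min (range \<nu>)"
  proof (rule antisym)
    show "Min (range \<nu>) \<le> (INF t. ?u t)"
      by (intro cINF_greatest Min_le_expectation) auto
    have "Min (range \<nu>) \<in> range \<nu>" by (intro Min_in) auto
    then obtain l where "Min (range \<nu>) = \<nu> l" by blast
    then have "Min (range \<nu>) = ?u (return_pmf l, undefined)" by simp
    moreover have "(INF t. ?u t) \<le> ?u (return_pmf l, undefined)"
      by (rule cINF_lower) (auto intro!: bdd_belowI[of _ "Min (range \<nu>)"] Min_le_expectation)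
    ultimately show "(INF t. ?u t) \<le> Min (range \<nu>)" by simp
  qed
  finally show ?thesis .
qed

definition worst_case1 :: "('k, 'l, 'a, 'b) game \<Rightarrow> nat \<Rightarrow> 'k pmf \<Rightarrow> 'l pmf \<Rightarrow>
    ('k, 'a, 'b) strategy1 \<Rightarrow> real" where
  "worst_case1 \<Gamma> N p q \<sigma> = (INF \<tau>. payoff \<Gamma> N p q \<sigma> \<tau>)"

definition worst_case2 :: "('k, 'l, 'a, 'b) game \<Rightarrow> nat \<Rightarrow> 'k pmf \<Rightarrow> 'l pmf \<Rightarrow>
    ('l, 'a, 'b) strategy2 \<Rightarrow> real" where
  "worst_case2 \<Gamma> N p q \<tau> = (SUP \<sigma>. payoff \<Gamma> N p q \<sigma> \<tau>)"

(* k_1 and l_1 are independent, so conditioning on l_1 = l (or k_1 = k) replaces the initial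
   distribution by a point mass; this also fixes the meaning when the state has probability 0. *)

definition alpha :: "('k, 'l, 'a, 'b) game \<Rightarrow> nat \<Rightarrow> 'k pmf \<Rightarrow> ('k, 'a, 'b) strategy1 \<Rightarrow>
    'l \<Rightarrow> real" where
  "alpha \<Gamma> n p \<sigma> l = (INF \<tau>. payoff \<Gamma> n p (return_pmf l) \<sigma> \<tau>)"

definition beta :: "('k, 'l, 'a, 'b) game \<Rightarrow> nat \<Rightarrow> 'l pmf \<Rightarrow> ('l, 'a, 'b) strategy2 \<Rightarrow>
    'k \<Rightarrow> real" where
  "beta \<Gamma> n q \<tau> k = (SUP \<sigma>. payoff \<Gamma> n (return_pmf k) q \<sigma> \<tau>)"

(* Belief updates, for either player: D is that player's transition kernel and act = fst or snd
   extracts his own action from the action pair x.  X s is the distribution written X(., s). *)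

definition act_prob :: "'s pmf \<Rightarrow> ('s::finite \<Rightarrow> 'c pmf) \<Rightarrow> 'c \<Rightarrow> real" where
  "act_prob p X c = (\<Sum>s\<in>UNIV. pmf p s * pmf (X s) c)"

definition belief_update :: "('x \<Rightarrow> 's \<Rightarrow> 's pmf) \<Rightarrow> ('x \<Rightarrow> 'c) \<Rightarrow> 's pmf \<Rightarrow>
    ('s::finite \<Rightarrow> 'c pmf) \<Rightarrow> 'x \<Rightarrow> 's pmf \<Rightarrow> bool" where
  "belief_update D act p X x p' \<longleftrightarrow> (act_prob p X (act x) \<noteq> 0 \<longrightarrow>
     (\<forall>s'. pmf p' s' =
        (\<Sum>s\<in>UNIV. pmf (D x s) s' * pmf p s * pmf (X s) (act x)) / act_prob p X (act x)))"

definition next_belief :: "('x \<Rightarrow> 's \<Rightarrow> 's pmf) \<Rightarrow> ('x \<Rightarrow> 'c) \<Rightarrow> 's pmf \<Rightarrow>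
    ('s::finite \<Rightarrow> 'c pmf) \<Rightarrow> 'x \<Rightarrow> 's pmf" where
  "next_belief D act p X x = (SOME p'. belief_update D act p X x p')"

lemma belief_update_next_belief:
  fixes p :: "'s::finite pmf"
  shows "belief_update D act p X x (next_belief D act p X x)"
proof -
  define Z where "Z = act_prob p X (act x)"
  define f where "f s' = (\<Sum>s\<in>UNIV. pmf (D x s) s' * pmf p s * pmf (X s) (act x)) / Z" for s'
  have "\<exists>p'. belief_update D act p X x p'"
  proof (cases "Z = 0")
    case True
    then show ?thesis by (auto simp: belief_update_def Z_def)
  next
    case False
    have "Z \<ge> 0" by (auto simp: Z_def act_prob_def intro!: sum_nonneg)
    then have nn: "f s' \<ge> 0" for s'
      by (auto simp: f_def intro!: sum_nonneg divide_nonneg_nonneg)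
    have "(\<Sum>s'\<in>UNIV. \<Sum>s\<in>UNIV. pmf (D x s) s' * pmf p s * pmf (X s) (act x))
        = (\<Sum>s\<in>UNIV. (\<Sum>s'\<in>UNIV. pmf (D x s) s') * (pmf p s * pmf (X s) (act x)))"
      by (subst sum.swap) (simp add: sum_distrib_right mult.assoc)
    also have "\<dots> = Z" by (simp add: sum_pmf_eq_1 Z_def act_prob_def)
    finally have "(\<Sum>s'\<in>UNIV. f s') = 1"
      using False by (simp add: f_def flip: sum_divide_distrib)
    then have "(\<integral>\<^sup>+s'. ennreal (f s') \<partial>count_space UNIV) = 1"
      using nn by (simp add: nn_integral_count_space_finite sum_ennreal)
    then have "pmf (embed_pmf f) s' = f s'" for s'
      using nn by (intro pmf_embed_pmf) auto
    then show ?thesis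
      by (intro exI[of _ "embed_pmf f"]) (simp add: belief_update_def f_def Z_def)
  qed
  then show ?thesis unfolding next_belief_def by (rule someI_ex)
qed

(* The player's own factor in the probability of the own history h followed by own state s:
   initial law, own transitions and own action choices (the opponent's choices cancel in
   stage_choice below). *)

primrec own_weight :: "('x \<Rightarrow> 's \<Rightarrow> 's pmf) \<Rightarrow> ('x \<Rightarrow> 'c) \<Rightarrow> 's pmf \<Rightarrow>
    ('s, 'x, 'c) strategy \<Rightarrow> ('s \<times> 'x) list \<Rightarrow> 's \<Rightarrow> real" where
  "own_weight D act p \<sigma> [] s = pmf p s"
| "own_weight D act p \<sigma> (y # h) s = (case y of (s', x) \<Rightarrow>
     own_weight D act p \<sigma> h s' * pmf (\<sigma> h s') (act x) * pmf (D x s') s)"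

(* X s is the conditional law of the player's action given the public history us of action pairs
   and the current own state s.  Past own states, on which a behavior strategy may depend, are
   averaged out; if \<sigma> depends only on us and s, then X s is the prescribed mixed action.
   X s is unconstrained if (us, s) has probability 0. *)

definition stage_choice :: "('x \<Rightarrow> 's \<Rightarrow> 's pmf) \<Rightarrow> ('x \<Rightarrow> 'c) \<Rightarrow> 's pmf \<Rightarrow>
    ('s::finite, 'x, 'c) strategy \<Rightarrow> 'x list \<Rightarrow> ('s \<Rightarrow> 'c pmf) \<Rightarrow> bool" where
  "stage_choice D act p \<sigma> us X \<longleftrightarrow>
     (\<forall>s. (\<Sum>h | map snd h = us. own_weight D act p \<sigma> h s) \<noteq> 0 \<longrightarrow>
        (\<forall>c. pmf (X s) c =
           (\<Sum>h | map snd h = us. own_weight D act p \<sigma> h s * pmf (\<sigma> h s) c) /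
           (\<Sum>h | map snd h = us. own_weight D act p \<sigma> h s)))"

(* Objectives, after the inner optimization over distributions on
   (opponent's action, opponent's state), of the recursive formulas for the
   values of the n-stage dual games.  The choice made in next_belief when act_prob = 0 is
   irrelevant here, as that term is multiplied by act_prob. *)

definition dual_objective2 :: "('k::finite, 'l::finite, 'a::finite, 'b::finite) game \<Rightarrow> nat \<Rightarrow>
    'k pmf \<Rightarrow> ('l \<Rightarrow> real) \<Rightarrow> ('k \<Rightarrow> 'a pmf) \<Rightarrow> ('a \<times> 'b \<Rightarrow> 'l \<Rightarrow> real) \<Rightarrow> real" where
  "dual_objective2 \<Gamma> n p \<nu> X \<alpha> = (INF \<psi> :: ('b \<times> 'l) pmf.
     \<Sum>b\<in>UNIV. \<Sum>l\<in>UNIV. pmf \<psi> (b, l) *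
       (\<nu> l + (\<Sum>k\<in>UNIV. \<Sum>a\<in>UNIV. pay \<Gamma> k l a b * pmf (X k) a * pmf p k)
        + disc \<Gamma> * (\<Sum>a\<in>UNIV. act_prob p X a *
            (dual_value2 \<Gamma> (n - 1) (next_belief (trans1 \<Gamma>) fst p X (a, b)) (\<alpha> (a, b))
             - (\<Sum>l'\<in>UNIV. pmf (trans2 \<Gamma> (a, b) l) l' * \<alpha> (a, b) l')))))"

definition dual_objective1 :: "('k::finite, 'l::finite, 'a::finite, 'b::finite) game \<Rightarrow> nat \<Rightarrow>
    ('k \<Rightarrow> real) \<Rightarrow> 'l pmf \<Rightarrow> ('l \<Rightarrow> 'b pmf) \<Rightarrow> ('a \<times> 'b \<Rightarrow> 'k \<Rightarrow> real) \<Rightarrow> real" where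
  "dual_objective1 \<Gamma> n \<mu> q Y \<beta> = (SUP \<phi> :: ('a \<times> 'k) pmf.
     \<Sum>a\<in>UNIV. \<Sum>k\<in>UNIV. pmf \<phi> (a, k) *
       (\<mu> k + (\<Sum>l\<in>UNIV. \<Sum>b\<in>UNIV. pay \<Gamma> k l a b * pmf (Y l) b * pmf q l)
        + disc \<Gamma> * (\<Sum>b\<in>UNIV. act_prob q Y b *
            (dual_value1 \<Gamma> (n - 1) (\<beta> (a, b)) (next_belief (trans2 \<Gamma>) snd q Y (a, b))
             - (\<Sum>k'\<in>UNIV. pmf (trans1 \<Gamma> (a, b) k) k' * \<beta> (a, b) k')))))"

definition dual_solution2 :: "('k::finite, 'l::finite, 'a::finite, 'b::finite) game \<Rightarrow> nat \<Rightarrow>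
    'k pmf \<Rightarrow> ('l \<Rightarrow> real) \<Rightarrow> ('k \<Rightarrow> 'a pmf) \<Rightarrow> ('a \<times> 'b \<Rightarrow> 'l \<Rightarrow> real) \<Rightarrow> bool" where
  "dual_solution2 \<Gamma> n p \<nu> X \<alpha> \<longleftrightarrow>
     (\<forall>X' \<alpha>'. dual_objective2 \<Gamma> n p \<nu> X' \<alpha>' \<le> dual_objective2 \<Gamma> n p \<nu> X \<alpha>)"

definition dual_solution1 :: "('k::finite, 'l::finite, 'a::finite, 'b::finite) game \<Rightarrow> nat \<Rightarrow>
    ('k \<Rightarrow> real) \<Rightarrow> 'l pmf \<Rightarrow> ('l \<Rightarrow> 'b pmf) \<Rightarrow> ('a \<times> 'b \<Rightarrow> 'k \<Rightarrow> real) \<Rightarrow> bool" where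
  "dual_solution1 \<Gamma> n \<mu> q Y \<beta> \<longleftrightarrow>
     (\<forall>Y' \<beta>'. dual_objective1 \<Gamma> n \<mu> q Y \<beta> \<le> dual_objective1 \<Gamma> n \<mu> q Y' \<beta>')"

(* bel us and \<nu> us (resp. \<mu> us) are the statistics p_t and nu_t (resp. q_t and mu_t) at stage
   t = length us + 1 after the public history us.  A history h @ g consists of the window's own
   stages h preceded by g, so from the start of a later window on, the optimal strategy \<rho> of the
   dual game sees only what happened inside the window. *)

definition window_strategy1 :: "('k::finite, 'l::finite, 'a::finite, 'b::finite) game \<Rightarrow> nat \<Rightarrow>
    nat \<Rightarrow> 'k pmf \<Rightarrow> 'l pmf \<Rightarrow> ('k, 'a, 'b) strategy1 \<Rightarrow> bool" where
  "window_strategy1 \<Gamma> n N p q \<sigma> \<longleftrightarrow>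
     (\<exists>\<sigma>0 (bel :: ('a \<times> 'b) list \<Rightarrow> 'k pmf) (\<nu> :: ('a \<times> 'b) list \<Rightarrow> 'l \<Rightarrow> real).
        optimal_max (payoff \<Gamma> n p q) \<sigma>0 \<and>
        (\<forall>h k. length h < n \<longrightarrow> \<sigma> h k = \<sigma>0 h k) \<and>
        bel [] = p \<and>
        \<nu> [] = (\<lambda>l. - alpha \<Gamma> n p \<sigma>0 l) \<and>
        (\<forall>us. length us < N \<longrightarrow>
           (\<exists>X. stage_choice (trans1 \<Gamma>) fst p \<sigma> us X \<and>
              (\<forall>x. belief_update (trans1 \<Gamma>) fst (bel us) X x (bel (x # us))))) \<and>
        (\<forall>us. length us < N \<longrightarrow>
           (\<exists>X \<alpha>. dual_solution2 \<Gamma> n (bel us) (\<nu> us) X \<alpha> \<and> (\<forall>x. \<nu> (x # us) = \<alpha> x))) \<and>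
        (\<forall>us. us \<noteq> [] \<and> n dvd length us \<and> length us < N \<longrightarrow>
           (\<exists>\<rho>. optimal_max (dual_payoff2 \<Gamma> (min n (N - length us)) (bel us) (\<nu> us)) \<rho> \<and>
              (\<forall>g h k. map snd g = us \<and> length h < min n (N - length us) \<longrightarrow>
                 \<sigma> (h @ g) k = \<rho> h k))))"

definition window_strategy2 :: "('k::finite, 'l::finite, 'a::finite, 'b::finite) game \<Rightarrow> nat \<Rightarrow>
    nat \<Rightarrow> 'k pmf \<Rightarrow> 'l pmf \<Rightarrow> ('l, 'a, 'b) strategy2 \<Rightarrow> bool" where
  "window_strategy2 \<Gamma> n N p q \<tau> \<longleftrightarrow>
     (\<exists>\<tau>0 (bel :: ('a \<times> 'b) list \<Rightarrow> 'l pmf) (\<mu> :: ('a \<times> 'b) list \<Rightarrow> 'k \<Rightarrow> real).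
        optimal_min (payoff \<Gamma> n p q) \<tau>0 \<and>
        (\<forall>h l. length h < n \<longrightarrow> \<tau> h l = \<tau>0 h l) \<and>
        bel [] = q \<and>
        \<mu> [] = (\<lambda>k. - beta \<Gamma> n q \<tau>0 k) \<and>
        (\<forall>us. length us < N \<longrightarrow>
           (\<exists>Y. stage_choice (trans2 \<Gamma>) snd q \<tau> us Y \<and>
              (\<forall>x. belief_update (trans2 \<Gamma>) snd (bel us) Y x (bel (x # us))))) \<and>
        (\<forall>us. length us < N \<longrightarrow>
           (\<exists>Y \<beta>. dual_solution1 \<Gamma> n (\<mu> us) (bel us) Y \<beta> \<and> (\<forall>x. \<mu> (x # us) = \<beta> x))) \<and>
        (\<forall>us. us \<noteq> [] \<and> n dvd length us \<and> length us < N \<longrightarrow>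
           (\<exists>\<rho>. optimal_min (dual_payoff1 \<Gamma> (min n (N - length us)) (\<mu> us) (bel us)) \<rho> \<and>
              (\<forall>g h l. map snd g = us \<and> length h < min n (N - length us) \<longrightarrow>
                 \<tau> (h @ g) l = \<rho> h l))))"

end

(* Both window strategies open with a security strategy of the n-stage game, and stages n+1,...,N
   contribute between 0 and the claimed bound.  Hence the worst case over N stages is within the
   bound of the n-stage security level, which the N-stage one dominates.  The later windows play
   no role.

   Since game_value is the max-min, player 2's half needs max-min = min-max for the n-stage game.
   The probability of a play factors into one own_weight per player, so payoffs are bilinear in
   these weights, and a convex combination of own_weights is again an own_weight (Kuhn).  The
   minimax theorem then follows by Kneser's induction over the finite set of pure strategies of
   player 2, against which any strategy of player 1 attains its worst case. *)

theory Submission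
  imports Defs
begin

section \<open>A minimax theorem for payoffs closed under mixing\<close>

text \<open>Strategies carry no linear structure, so a mixture is any element of \<open>S\<close>
  whose payoff against every \<open>t\<close> is the convex combination: an affine form of Ky Fan's
  convexlike condition. With the arguments of \<open>u\<close> swapped it expresses the same for the
  minimizer.\<close>

definition mixable :: "('s \<Rightarrow> 't \<Rightarrow> real) \<Rightarrow> 's set \<Rightarrow> bool" where
  "mixable u S \<longleftrightarrow> (\<forall>s1\<in>S. \<forall>s2\<in>S. \<forall>w. 0 \<le> w \<and> w \<le> 1 \<longrightarrow>
     (\<exists>s\<in>S. \<forall>t. u s t = (1 - w) * u s1 t + w * u s2 t))"

lemma mixable_superlevel:
  assumes "mixable u S"
  shows "mixable u {s\<in>S. c \<le> u s t}"
  unfolding mixable_def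
proof (intro ballI allI impI)
  fix s1 s2 and w :: real
  assume s: "s1 \<in> {s\<in>S. c \<le> u s t}" "s2 \<in> {s\<in>S. c \<le> u s t}" and w: "0 \<le> w \<and> w \<le> 1"
  then obtain s where "s \<in> S" and eq: "\<And>t. u s t = (1 - w) * u s1 t + w * u s2 t"
    using assms unfolding mixable_def by blast
  have "(1 - w) * c + w * c \<le> (1 - w) * u s1 t + w * u s2 t"
    using s w by (intro add_mono mult_left_mono) auto
  then have "c \<le> u s t" by (simp add: eq algebra_simps)
  with \<open>s \<in> S\<close> eq show
    "\<exists>s\<in>{s\<in>S. c \<le> u s t}. \<forall>t. u s t = (1 - w) * u s1 t + w * u s2 t" by blast
qed

text \<open>The payoff pairs against \<open>t1\<close> and \<open>t2\<close> form a convex set in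
  the plane. If it missed the quadrant above \<open>(c, c)\<close>, a separating line would have a
  nonnegative normal; normalized, this normal gives the weights of a mixture \<open>t\<close> of
  \<open>t1\<close> and \<open>t2\<close> that holds every \<open>s\<close> to at most
  \<open>c\<close>, although some \<open>s\<close> reaches \<open>d\<close> against
  \<open>t\<close>.\<close>

lemma simultaneous_superlevel:
  fixes u :: "'s \<Rightarrow> 't \<Rightarrow> real"
  assumes S: "mixable u S" and T: "mixable (\<lambda>t s. u s t) UNIV"
    and above: "\<And>t. \<exists>s\<in>S. d \<le> u s t" and "c < d"
  shows "\<exists>s\<in>S. c \<le> u s t1 \<and> c \<le> u s t2"
proof (rule ccontr)
  assume none: "\<not> ?thesis"
  define A where "A = (\<lambda>s. (u s t1, u s t2)) ` S"
  have "convex A"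
    unfolding convex_alt
  proof (intro ballI allI impI)
    fix x y and w :: real
    assume xy: "x \<in> A" "y \<in> A" and w: "0 \<le> w \<and> w \<le> 1"
    then obtain s1 s2 where s: "s1 \<in> S" "s2 \<in> S"
      "x = (u s1 t1, u s1 t2)" "y = (u s2 t1, u s2 t2)"
      by (auto simp: A_def)
    with w S obtain s where "s \<in> S" "\<And>t. u s t = (1 - w) * u s1 t + w * u s2 t"
      unfolding mixable_def by blast
    then have "(1 - w) *\<^sub>R x + w *\<^sub>R y = (u s t1, u s t2)" using s by simp
    with \<open>s \<in> S\<close> show "(1 - w) *\<^sub>R x + w *\<^sub>R y \<in> A" by (simp add: A_def)
  qed
  moreover have "convex ({c..} \<times> {c..})" by (intro convex_Times convex_real_interval)
  moreover have "A \<noteq> {}" using above by (auto simp: A_def)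
  moreover have "{c..} \<times> {c..} \<noteq> {}" by auto
  moreover have "A \<inter> {c..} \<times> {c..} = {}" using none by (auto simp: A_def)
  ultimately obtain e r where "e \<noteq> 0" and eA: "\<And>x. x \<in> A \<Longrightarrow> e \<bullet> x \<le> r"
    and eC: "\<And>x. x \<in> {c..} \<times> {c..} \<Longrightarrow> r \<le> e \<bullet> x"
    using separating_hyperplane_sets[of A "{c..} \<times> {c..}"] by blast
  obtain e1 e2 where e: "e = (e1, e2)" by (cases e)
  have r: "r \<le> e1 * x + e2 * y" if "c \<le> x" "c \<le> y" for x y
    using eC[of "(x, y)"] that by (simp add: e inner_prod_def)
  \<comment> \<open>The quadrant is unbounded in each coordinate, so a negative coefficient would
    push the functional below its bound on the quadrant; the \<open>x\<close> chosen below already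
    brings it to \<open>r' - 1\<close>.\<close>
  have nonneg: "0 \<le> e'" if "\<And>x. c \<le> x \<Longrightarrow> r' \<le> e' * x" for e' r' :: real
  proof (rule ccontr)
    assume "\<not> 0 \<le> e'"
    then have neg: "e' < 0" by simp
    define x where "x = max c ((r' - 1) / e')"
    have "e' * x \<le> e' * ((r' - 1) / e')"
      using neg by (intro mult_left_mono_neg) (auto simp: x_def)
    also have "\<dots> = r' - 1" using neg by simp
    finally show False using that[of x] by (simp add: x_def)
  qed
  have "0 \<le> e1" by (rule nonneg[of "r - e2 * c"]) (use r[of _ c] in \<open>simp add: algebra_simps\<close>)
  moreover have "0 \<le> e2"
    by (rule nonneg[of "r - e1 * c"]) (use r[of c] in \<open>simp add: algebra_simps\<close>)
  ultimately have pos: "0 < e1 + e2" using \<open>e \<noteq> 0\<close> by (auto simp: e zero_prod_def)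
  define w where "w = e2 / (e1 + e2)"
  have "0 \<le> w" "w \<le> 1" and w12: "(e1 + e2) * (1 - w) = e1" "(e1 + e2) * w = e2"
    using \<open>0 \<le> e1\<close> \<open>0 \<le> e2\<close> pos by (auto simp: w_def field_simps)
  then obtain t where t: "\<And>s. u s t = (1 - w) * u s t1 + w * u s t2"
    using T unfolding mixable_def by blast
  obtain s where "s \<in> S" "d \<le> u s t" using above by blast
  have "(e1 + e2) * d \<le> (e1 + e2) * u s t"
    using \<open>d \<le> u s t\<close> pos by simp
  also have "\<dots> = e1 * u s t1 + e2 * u s t2"
    unfolding t by (simp add: w12 distrib_left flip: mult.assoc)
  also have "\<dots> \<le> r"
    using eA[of "(u s t1, u s t2)"] \<open>s \<in> S\<close> by (simp add: A_def e inner_prod_def)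
  also have "\<dots> \<le> (e1 + e2) * c" using r[of c c] by (simp add: algebra_simps)
  finally show False using pos \<open>c < d\<close> by simp
qed

text \<open>Restricting S to a superlevel set of one column preserves the hypotheses.\<close>

lemma finite_simultaneous_superlevel:
  fixes u :: "'s \<Rightarrow> 't \<Rightarrow> real"
  assumes "finite F" and "mixable u S" and "mixable (\<lambda>t s. u s t) UNIV"
    and "\<And>t. \<exists>s\<in>S. d \<le> u s t" and "c < d"
  shows "\<exists>s\<in>S. \<forall>t\<in>F. c \<le> u s t"
  using assms
proof (induction F arbitrary: S d rule: finite_induct)
  case empty
  then show ?case by blast
next
  case (insert t0 F)
  \<comment> \<open>Two columns can be treated together only at a strictly lower level, so each
    column costs a drop. Stopping at \<open>c'\<close> leaves room for the columns in
    \<open>F\<close>: the restricted set takes \<open>c'\<close> in the place of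
    \<open>d\<close>.\<close>
  obtain c' where c': "c < c'" "c' < d" using dense[OF \<open>c < d\<close>] by blast
  have "\<exists>s\<in>{s\<in>S. c' \<le> u s t0}. c' \<le> u s t" for t
    using simultaneous_superlevel[OF insert.prems(1,2,3) c'(2), of t0 t] by blast
  from insert.IH[OF mixable_superlevel[OF insert.prems(1)] insert.prems(2) this c'(1)]
  show ?case using c'(1) by fastforce
qed

text \<open>Finiteness of \<open>F\<close> takes the place of compactness: for \<open>c\<close>
  below the min-max some \<open>s\<close> secures \<open>c\<close> against all of \<open>F\<close>,
  and \<open>F\<close> contains a reply at least as good for the minimizer as any given
  \<open>t\<close>, so \<open>s\<close> secures \<open>c\<close> outright. The bounds
  \<open>L\<close> and \<open>U\<close> make the real suprema and infima meaningful.\<close>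

lemma minimax:
  fixes u :: "'s \<Rightarrow> 't \<Rightarrow> real"
  assumes S: "mixable u UNIV" and T: "mixable (\<lambda>t s. u s t) UNIV"
    and F: "finite F" "\<And>s t. \<exists>t'\<in>F. u s t' \<le> u s t"
    and bnd: "\<And>s t. L \<le> u s t" "\<And>s t. u s t \<le> U"
  shows "(INF t. SUP s. u s t) \<le> (SUP s. INF t. u s t)"
proof (rule dense_le)
  fix c assume "c < (INF t. SUP s. u s t)"
  then obtain d where d: "c < d" "d < (INF t. SUP s. u s t)" using dense by blast
  have bddS: "bdd_above (range (\<lambda>s. u s t))" for t
    by (rule bdd_aboveI2) (rule bnd(2))
  have bddT: "bdd_below (range (u s))" for s
    by (rule bdd_belowI2) (rule bnd(1))
  have "\<exists>s\<in>UNIV. d \<le> u s t" for t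
  proof -
    have "(INF t. SUP s. u s t) \<le> (SUP s. u s t)"
      by (rule cINF_lower)
        (use bnd(1) bddS in \<open>auto intro!: bdd_belowI2[of _ L] intro: cSUP_upper2\<close>)
    with d have "d < (SUP s. u s t)" by simp
    then show ?thesis using less_cSUP_iff[OF _ bddS, of d t] by (auto intro: less_imp_le)
  qed
  from finite_simultaneous_superlevel[OF F(1) S T this d(1)]
  obtain s where s: "\<And>t. t \<in> F \<Longrightarrow> c \<le> u s t" by blast
  have "c \<le> u s t" for t using s F(2)[of s t] by force
  then have "c \<le> (INF t. u s t)" by (intro cINF_greatest) auto
  also have "\<dots> \<le> (SUP s. INF t. u s t)"
  proof (rule cSUP_upper)
    show "bdd_above (range (\<lambda>s. INF t. u s t))"
      using bnd(2) bddT by (auto intro!: bdd_aboveI2[of _ _ U] intro: cINF_lower2)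
  qed simp
  finally show "c \<le> (SUP s. INF t. u s t)" .
qed

section \<open>Own weights: mixing strategies and purifying one decision\<close>

lemma own_weight_nonneg: "0 \<le> own_weight D act p \<sigma> h s"
  by (induction h arbitrary: s) (auto split: prod.splits)

lemma own_weight_cong:
  assumes "\<And>g s. length g < length h \<Longrightarrow> \<sigma> g s = \<sigma>' g s"
  shows "own_weight D act p \<sigma> h s = own_weight D act p \<sigma>' h s"
  using assms by (induction h arbitrary: s) (auto split: prod.splits)

text \<open>One coin flip before play between \<open>\<sigma>1\<close> and \<open>\<sigma>2\<close>
  is imitated by a fresh coin at every own history, biased by the posterior probability that
  \<open>\<sigma>2\<close> is in use. The mixed weight of the history then splits back into the two
  original summands, each followed by its own strategy.\<close>

lemma own_weight_mixture:
  assumes w: "0 \<le> w" "w \<le> 1"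
  shows "\<exists>\<sigma>. \<forall>h s. own_weight D act p \<sigma> h s =
    (1 - w) * own_weight D act p \<sigma>1 h s + w * own_weight D act p \<sigma>2 h s"
proof -
  define W1 where "W1 = own_weight D act p \<sigma>1"
  define W2 where "W2 = own_weight D act p \<sigma>2"
  define W where "W h s = (1 - w) * W1 h s + w * W2 h s" for h s
  \<comment> \<open>The posterior of \<open>\<sigma>2\<close> at \<open>(h, s)\<close>. Where
    \<open>W h s\<close> is 0 the division yields 0, which is harmless: both nonnegative summands of
    \<open>W h s\<close> vanish there, so the identities \<open>Wv\<close> still hold.\<close>
  define v where "v h s = w * W2 h s / W h s" for h s
  define \<sigma> where "\<sigma> h s = bind_pmf (bernoulli_pmf (v h s)) (\<lambda>b. if b then \<sigma>2 h s else \<sigma>1 h s)"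
    for h s
  have nn: "0 \<le> (1 - w) * W1 h s" "0 \<le> w * W2 h s" for h s
    using w by (auto simp: W1_def W2_def own_weight_nonneg)
  have v: "0 \<le> v h s" "v h s \<le> 1" for h s
    using nn[of h s] by (auto simp: v_def W_def divide_le_eq)
  have Wv: "W h s * v h s = w * W2 h s" "W h s * (1 - v h s) = (1 - w) * W1 h s" for h s
  proof -
    show *: "W h s * v h s = w * W2 h s"
      using nn[of h s] add_nonneg_eq_0_iff[OF nn, of h s] by (cases "W h s = 0") (auto simp: v_def W_def)
    show "W h s * (1 - v h s) = (1 - w) * W1 h s"
      using * by (simp add: W_def algebra_simps)
  qed
  have pmf_\<sigma>: "pmf (\<sigma> h s) c = v h s * pmf (\<sigma>2 h s) c + (1 - v h s) * pmf (\<sigma>1 h s) c" for h s c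
    using v[of h s] by (simp add: \<sigma>_def pmf_bind)
  have "own_weight D act p \<sigma> h s = W h s" for h s
  proof (induction h arbitrary: s)
    case Nil
    then show ?case by (simp add: W_def W1_def W2_def algebra_simps)
  next
    case (Cons y h)
    obtain s' x where y: "y = (s', x)" by (cases y)
    have "own_weight D act p \<sigma> (y # h) s =
        (W h s' * v h s' * pmf (\<sigma>2 h s') (act x) + W h s' * (1 - v h s') * pmf (\<sigma>1 h s') (act x))
          * pmf (D x s') s"
      by (simp add: y Cons.IH pmf_\<sigma> algebra_simps)
    also have "\<dots> = W (y # h) s"
      unfolding Wv by (simp add: y W_def W1_def W2_def algebra_simps)
    finally show ?case .
  qed
  then show ?thesis unfolding W_def W1_def W2_def by blast
qed

text \<open>A history passes through the decision point \<open>(h0, s0)\<close> at most once, since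
  its prefixes have distinct lengths. Its weight is therefore affine in the mixed action at that
  point and equals the average over the pure actions there.\<close>

lemma own_weight_fun_upd:
  fixes \<sigma> :: "('s, 'x, 'c::finite) strategy"
  shows "own_weight D act p \<sigma> h s =
    (\<Sum>c\<in>UNIV. pmf (\<sigma> h0 s0) c * own_weight D act p (\<sigma>(h0 := (\<sigma> h0)(s0 := return_pmf c))) h s)"
proof (induction h arbitrary: s)
  case Nil
  then show ?case by (simp add: sum_pmf_eq_1 flip: sum_distrib_right)
next
  case (Cons y h)
  obtain s' x where y: "y = (s', x)" by (cases y)
  show ?case
  proof (cases "h = h0 \<and> s' = s0")
    \<comment> \<open>The decision point is the latest one: the earlier weight consults only shorter
      histories and ignores the update, and the sum keeps just the term with
      \<open>c = act x\<close>.\<close>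
    case True
    have "own_weight D act p (\<sigma>(h0 := (\<sigma> h0)(s0 := return_pmf c))) h s' = own_weight D act p \<sigma> h s'"
      for c by (rule own_weight_cong) (use True in auto)
    moreover have "(\<sigma>(h0 := (\<sigma> h0)(s0 := return_pmf c))) h s' = return_pmf c" for c
      using True by simp
    moreover have "(\<Sum>c\<in>UNIV. pmf (\<sigma> h0 s0) c * (r * pmf (return_pmf c) (act x) * r'))
        = r * pmf (\<sigma> h s') (act x) * r'" for r r'
      using True
      by (subst sum.remove[of _ "act x"]) (auto intro!: sum.neutral)
    ultimately show ?thesis by (simp only: y own_weight.simps prod.case)
  next
    case False
    then have "(\<sigma>(h0 := (\<sigma> h0)(s0 := return_pmf c))) h s' = \<sigma> h s'" for c by auto
    then show ?thesis
      unfolding y own_weight.simps prod.case Cons.IH[of s']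
      by (simp only: sum_distrib_right mult.assoc)
  qed
qed

section \<open>Product form of the law of play\<close>

lemma pmf_bind_eq_single:
  assumes "\<And>y. y \<noteq> y0 \<Longrightarrow> pmf (f y) x = 0"
  shows "pmf (bind_pmf M f) x = pmf M y0 * pmf (f y0) x"
  unfolding pmf_bind
  by (subst integral_measure_pmf_real[of "{y0}"]) (use assms in auto)

text \<open>A record stores the whole past, so each nested bind in \<open>play\<close> has a single
  outcome that can lead to a given record and collapses to one factor. The factors then sort by
  player, because the actions, and given them the transitions, are drawn independently.\<close>

lemma pmf_play:
  "pmf (play \<Gamma> p q \<sigma> \<tau> m) (h, k, l) = (if length h = m then
     own_weight (trans1 \<Gamma>) fst p \<sigma> (view1 h) k * own_weight (trans2 \<Gamma>) snd q \<tau> (view2 h) l else 0)"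
proof (induction m arbitrary: h k l)
  case 0
  have "pmf (play \<Gamma> p q \<sigma> \<tau> 0) (h, k, l) =
      pmf (pair_pmf p q) (k, l) * pmf (return_pmf ([], k, l)) (h, k, l)"
    unfolding play.simps map_pmf_def
    by (subst pmf_bind_eq_single[of "(k, l)"]) auto
  then show ?case by (auto simp: pmf_pair view1_def view2_def)
next
  case (Suc m)
  show ?case
  proof (cases h)
    case Nil
    then show ?thesis by (auto simp: pmf_eq_0_set_pmf)
  next
    case (Cons y h')
    obtain k0 l0 a b where y: "y = (k0, l0, a, b)" by (cases y)
    have "pmf (play \<Gamma> p q \<sigma> \<tau> (Suc m)) (h, k, l) = pmf (play \<Gamma> p q \<sigma> \<tau> m) (h', k0, l0) *
        (pmf (pair_pmf (\<sigma> (view1 h') k0) (\<tau> (view2 h') l0)) (a, b) *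
        (pmf (pair_pmf (trans1 \<Gamma> (a, b) k0) (trans2 \<Gamma> (a, b) l0)) (k, l)))"
      unfolding play.simps Cons y
      apply (subst pmf_bind_eq_single[of "(h', k0, l0)"])
       apply (force simp: pmf_eq_0_set_pmf)
      apply simp
      apply (subst pmf_bind_eq_single[of "(a, b)"])
       apply (force simp: pmf_eq_0_set_pmf)
      apply simp
      apply (subst pmf_bind_eq_single[of "(k, l)"])
       apply (auto split: prod.splits)[1]
      apply simp
      done
    then show ?thesis by (simp add: Suc.IH Cons y pmf_pair view1_def view2_def)
  qed
qed

lemma set_pmf_play: "set_pmf (play \<Gamma> p q \<sigma> \<tau> m) \<subseteq> {h. length h = m} \<times> UNIV"
  by (auto simp: set_pmf_eq pmf_play split: if_splits)

lemma finite_records: "finite ({h :: 'z::finite list. length h = m} \<times> (UNIV :: 's::finite set))"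
  using finite_lists_length_eq[of "UNIV :: 'z set" m] by simp

lemma integrable_play:
  fixes \<Gamma> :: "('k::finite, 'l::finite, 'a::finite, 'b::finite) game" and f :: "_ \<Rightarrow> real"
  shows "integrable (play \<Gamma> p q \<sigma> \<tau> m) f"
  by (intro integrable_measure_pmf_finite finite_subset[OF set_pmf_play] finite_records)

text \<open>The sum runs over all records of length \<open>m\<close>, not over the support of the
  play, so the index set is the same for all strategies and payoffs can be combined term by
  term.\<close>

lemma payoff_eq_sum:
  fixes \<Gamma> :: "('k::finite, 'l::finite, 'a::finite, 'b::finite) game"
  shows "payoff \<Gamma> m p q \<sigma> \<tau> = (\<Sum>(h, k, l)\<in>{h. length h = m} \<times> UNIV.
     total_pay \<Gamma> h * own_weight (trans1 \<Gamma>) fst p \<sigma> (view1 h) k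
       * own_weight (trans2 \<Gamma>) snd q \<tau> (view2 h) l)"
  unfolding payoff_def
  by (subst integral_measure_pmf_real[OF finite_records[of m]])
    (use set_pmf_play in \<open>fastforce intro!: sum.cong simp: pmf_play\<close>)+

lemma length_view: "length (view1 h) = length h" "length (view2 h) = length h"
  by (simp_all add: view1_def view2_def)

lemma payoff_cong:
  fixes \<Gamma> :: "('k::finite, 'l::finite, 'a::finite, 'b::finite) game"
  assumes "\<And>h k. length h < m \<Longrightarrow> \<sigma> h k = \<sigma>' h k" and "\<And>h l. length h < m \<Longrightarrow> \<tau> h l = \<tau>' h l"
  shows "payoff \<Gamma> m p q \<sigma> \<tau> = payoff \<Gamma> m p q \<sigma>' \<tau>'"
proof -
  have "own_weight (trans1 \<Gamma>) fst p \<sigma> (view1 h) k = own_weight (trans1 \<Gamma>) fst p \<sigma>' (view1 h) k"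
    "own_weight (trans2 \<Gamma>) snd q \<tau> (view2 h) l = own_weight (trans2 \<Gamma>) snd q \<tau>' (view2 h) l"
    if "length h = m" for h k l
    using that assms by (auto intro!: own_weight_cong simp: length_view)
  then show ?thesis unfolding payoff_eq_sum by (intro sum.cong) auto
qed

section \<open>Mixtures of payoffs and finitely many best replies\<close>

lemma mixable_payoff1:
  fixes \<Gamma> :: "('k::finite, 'l::finite, 'a::finite, 'b::finite) game"
  shows "mixable (payoff \<Gamma> m p q) UNIV"
  unfolding mixable_def
proof (intro ballI allI impI)
  fix \<sigma>1 \<sigma>2 and w :: real assume "0 \<le> w \<and> w \<le> 1"
  then obtain \<sigma> where eq: "\<And>h s. own_weight (trans1 \<Gamma>) fst p \<sigma> h s = (1 - w) *
      own_weight (trans1 \<Gamma>) fst p \<sigma>1 h s + w * own_weight (trans1 \<Gamma>) fst p \<sigma>2 h s"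
    using own_weight_mixture by metis
  have "payoff \<Gamma> m p q \<sigma> \<tau> = (1 - w) * payoff \<Gamma> m p q \<sigma>1 \<tau> + w * payoff \<Gamma> m p q \<sigma>2 \<tau>" for \<tau>
    unfolding payoff_eq_sum sum_distrib_left
    by (subst sum.distrib[symmetric], intro sum.cong) (auto simp: eq algebra_simps)
  then show "\<exists>\<sigma>\<in>UNIV. \<forall>\<tau>. payoff \<Gamma> m p q \<sigma> \<tau> =
      (1 - w) * payoff \<Gamma> m p q \<sigma>1 \<tau> + w * payoff \<Gamma> m p q \<sigma>2 \<tau>" by blast
qed

lemma mixable_payoff2:
  fixes \<Gamma> :: "('k::finite, 'l::finite, 'a::finite, 'b::finite) game"
  shows "mixable (\<lambda>\<tau> \<sigma>. payoff \<Gamma> m p q \<sigma> \<tau>) UNIV"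
  unfolding mixable_def
proof (intro ballI allI impI)
  fix \<tau>1 \<tau>2 and w :: real assume "0 \<le> w \<and> w \<le> 1"
  then obtain \<tau> where eq: "\<And>h s. own_weight (trans2 \<Gamma>) snd q \<tau> h s = (1 - w) *
      own_weight (trans2 \<Gamma>) snd q \<tau>1 h s + w * own_weight (trans2 \<Gamma>) snd q \<tau>2 h s"
    using own_weight_mixture by metis
  have "payoff \<Gamma> m p q \<sigma> \<tau> = (1 - w) * payoff \<Gamma> m p q \<sigma> \<tau>1 + w * payoff \<Gamma> m p q \<sigma> \<tau>2" for \<sigma>
    unfolding payoff_eq_sum sum_distrib_left
    by (subst sum.distrib[symmetric], intro sum.cong) (auto simp: eq algebra_simps)
  then show "\<exists>\<tau>\<in>UNIV. \<forall>\<sigma>. payoff \<Gamma> m p q \<sigma> \<tau> =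
      (1 - w) * payoff \<Gamma> m p q \<sigma> \<tau>1 + w * payoff \<Gamma> m p q \<sigma> \<tau>2" by blast
qed

text \<open>The payoff is the average, with weights \<open>\<tau> h0 l0\<close>, of the payoffs
  after fixing the action at \<open>(h0, l0)\<close>, and not every term can exceed its average. The
  strict inequality comes from an action in the support.\<close>

lemma derandomize_at:
  fixes \<Gamma> :: "('k::finite, 'l::finite, 'a::finite, 'b::finite) game"
  shows "\<exists>b. payoff \<Gamma> m p q \<sigma> (\<tau>(h0 := (\<tau> h0)(l0 := return_pmf b))) \<le> payoff \<Gamma> m p q \<sigma> \<tau>"
proof (rule ccontr)
  assume "\<not> ?thesis"
  then have less: "payoff \<Gamma> m p q \<sigma> \<tau> < payoff \<Gamma> m p q \<sigma> (\<tau>(h0 := (\<tau> h0)(l0 := return_pmf b)))"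
    for b by (simp add: not_le)
  have "payoff \<Gamma> m p q \<sigma> \<tau> = (\<Sum>b\<in>UNIV. pmf (\<tau> h0 l0) b *
      payoff \<Gamma> m p q \<sigma> (\<tau>(h0 := (\<tau> h0)(l0 := return_pmf b))))"
    unfolding payoff_eq_sum sum_distrib_left
    apply (subst sum.swap)
    apply (intro sum.cong refl)
    apply (clarsimp simp only: prod.case)
    apply (subst own_weight_fun_upd[of _ _ _ _ _ _ h0 l0])
    apply (simp only: sum_distrib_left ac_simps)
    done
  also have "\<dots> > (\<Sum>b\<in>UNIV. pmf (\<tau> h0 l0) b * payoff \<Gamma> m p q \<sigma> \<tau>)"
  proof (rule sum_strict_mono_ex1)
    obtain b where "b \<in> set_pmf (\<tau> h0 l0)" using set_pmf_not_empty by fast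
    then show "\<exists>b\<in>UNIV. pmf (\<tau> h0 l0) b * payoff \<Gamma> m p q \<sigma> \<tau> <
        pmf (\<tau> h0 l0) b * payoff \<Gamma> m p q \<sigma> (\<tau>(h0 := (\<tau> h0)(l0 := return_pmf b)))"
      by (intro bexI[of _ b] mult_strict_left_mono less pmf_positive) simp_all
  qed (auto intro!: mult_left_mono less_imp_le[OF less])
  finally show False by (simp add: sum_pmf_eq_1 flip: sum_distrib_right)
qed

text \<open>Points are purified one at a time; a further update leaves the earlier points pure and
  does not raise the payoff.\<close>

lemma derandomize_on:
  fixes \<Gamma> :: "('k::finite, 'l::finite, 'a::finite, 'b::finite) game"
  assumes "finite H"
  shows "\<exists>\<tau>'. (\<forall>(h, l)\<in>H. \<exists>b. \<tau>' h l = return_pmf b) \<and>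
    payoff \<Gamma> m p q \<sigma> \<tau>' \<le> payoff \<Gamma> m p q \<sigma> \<tau>"
  using assms
proof (induction H rule: finite_induct)
  case empty
  then show ?case by auto
next
  case (insert z H)
  obtain h0 l0 where z: "z = (h0, l0)" by (cases z)
  from insert.IH obtain \<tau>' where \<tau>': "\<forall>(h, l)\<in>H. \<exists>b. \<tau>' h l = return_pmf b"
    "payoff \<Gamma> m p q \<sigma> \<tau>' \<le> payoff \<Gamma> m p q \<sigma> \<tau>" by blast
  obtain b where b: "payoff \<Gamma> m p q \<sigma> (\<tau>'(h0 := (\<tau>' h0)(l0 := return_pmf b))) \<le> payoff \<Gamma> m p q \<sigma> \<tau>'"
    using derandomize_at by blast
  show ?case
    by (intro exI[of _ "\<tau>'(h0 := (\<tau>' h0)(l0 := return_pmf b))"] conjI order_trans[OF b \<tau>'(2)])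
      (use \<tau>'(1) z in auto)
qed

text \<open>Supplies the finite test set for \<open>minimax\<close>: only finitely many decision
  points occur within \<open>m\<close> stages, and purifying all of them leaves finitely many
  replies up to values at longer histories.\<close>

lemma finite_best_replies:
  fixes \<Gamma> :: "('k::finite, 'l::finite, 'a::finite, 'b::finite) game"
  shows "\<exists>F. finite F \<and> (\<forall>\<sigma> \<tau>. \<exists>\<tau>'\<in>F. payoff \<Gamma> m p q \<sigma> \<tau>' \<le> payoff \<Gamma> m p q \<sigma> \<tau>)"
proof -
  define H where "H = {h :: ('l \<times> 'a \<times> 'b) list. length h < m} \<times> (UNIV :: 'l set)"
  \<comment> \<open>A fixed default outside \<open>H\<close>; without it the pure strategies would
    vary freely at long histories and \<open>E\<close> would be infinite.\<close>
  define d where "d = return_pmf (undefined :: 'b)"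
  define E where "E = {f. \<forall>z. (z \<in> H \<longrightarrow> f z \<in> range (return_pmf :: 'b \<Rightarrow> _)) \<and> (z \<notin> H \<longrightarrow> f z = d)}"
  have "finite H"
  proof -
    have "{h :: ('l \<times> 'a \<times> 'b) list. length h < m} \<subseteq> {h. set h \<subseteq> UNIV \<and> length h \<le> m}" by auto
    then have "finite {h :: ('l \<times> 'a \<times> 'b) list. length h < m}"
      by (rule finite_subset) (rule finite_lists_length_le[OF finite])
    then show ?thesis by (simp add: H_def)
  qed
  have "finite E"
    unfolding E_def by (rule finite_set_of_finite_funs) (use \<open>finite H\<close> in auto)
  moreover have "\<exists>\<tau>'\<in>curry ` E. payoff \<Gamma> m p q \<sigma> \<tau>' \<le> payoff \<Gamma> m p q \<sigma> \<tau>" for \<sigma> \<tau>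
  proof -
    obtain \<tau>' where \<tau>': "\<forall>(h, l)\<in>H. \<exists>b. \<tau>' h l = return_pmf b"
      "payoff \<Gamma> m p q \<sigma> \<tau>' \<le> payoff \<Gamma> m p q \<sigma> \<tau>"
      using derandomize_on[OF \<open>finite H\<close>] by blast
    define f where "f z = (if z \<in> H then case_prod \<tau>' z else d)" for z
    have "f \<in> E" using \<tau>'(1) by (auto simp: f_def E_def)
    moreover have "payoff \<Gamma> m p q \<sigma> (curry f) = payoff \<Gamma> m p q \<sigma> \<tau>'"
      by (rule payoff_cong) (auto simp: f_def H_def)
    ultimately show ?thesis using \<tau>'(2) by (intro bexI[of _ "curry f"]) auto
  qed
  ultimately show ?thesis by (intro exI[of _ "curry ` E"]) auto
qed

section \<open>Dependence of the payoff on the horizon\<close>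

lemma total_pay_Cons:
  "total_pay \<Gamma> ((k, l, a, b) # h) = total_pay \<Gamma> h + disc \<Gamma> ^ length h * pay \<Gamma> k l a b"
  by (simp add: total_pay_def nth_append)

lemma map_tl_play:
  "map_pmf (\<lambda>z. tl (fst z)) (play \<Gamma> p q \<sigma> \<tau> (Suc m)) = map_pmf fst (play \<Gamma> p q \<sigma> \<tau> m)"
  by (simp add: map_bind_pmf case_prod_beta map_pmf_def bind_assoc_pmf bind_return_pmf)

text \<open>The head of a record is the stage played last, number \<open>Suc m\<close>, hence the
  discount exponent \<open>m\<close>. Dropping it with \<open>tl\<close> leaves a record of the
  \<open>m\<close>-stage game with the right law.\<close>

lemma payoff_Suc:
  fixes \<Gamma> :: "('k::finite, 'l::finite, 'a::finite, 'b::finite) game"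
  shows "payoff \<Gamma> (Suc m) p q \<sigma> \<tau> = payoff \<Gamma> m p q \<sigma> \<tau> + disc \<Gamma> ^ m *
    measure_pmf.expectation (play \<Gamma> p q \<sigma> \<tau> (Suc m))
      (\<lambda>z. case hd (fst z) of (k, l, a, b) \<Rightarrow> pay \<Gamma> k l a b)"
proof -
  let ?M = "play \<Gamma> p q \<sigma> \<tau> (Suc m)"
  let ?g = "\<lambda>z. case hd (fst z) of (k, l, a, b) \<Rightarrow> pay \<Gamma> k l a b"
  have "payoff \<Gamma> (Suc m) p q \<sigma> \<tau> =
      measure_pmf.expectation ?M (\<lambda>z. total_pay \<Gamma> (tl (fst z)) + disc \<Gamma> ^ m * ?g z)"
    unfolding payoff_def
  \<comment> \<open>The splitting of the total holds only for records of length
    \<open>Suc m\<close>, that is, almost surely.\<close>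
  proof (rule integral_cong_AE)
    have "total_pay \<Gamma> (fst z) = total_pay \<Gamma> (tl (fst z)) + disc \<Gamma> ^ m * ?g z" if "z \<in> set_pmf ?M" for z
    proof -
      have "length (fst z) = Suc m" using subsetD[OF set_pmf_play that] by auto
      then obtain k l a b h where "fst z = (k, l, a, b) # h" "length h = m"
        by (auto simp: length_Suc_conv)
      then show ?thesis by (simp add: total_pay_Cons)
    qed
    then show "AE z in ?M. total_pay \<Gamma> (fst z) = total_pay \<Gamma> (tl (fst z)) + disc \<Gamma> ^ m * ?g z"
      by (simp only: AE_measure_pmf_iff) blast
  qed auto
  also have "\<dots> = measure_pmf.expectation ?M (\<lambda>z. total_pay \<Gamma> (tl (fst z)))
      + disc \<Gamma> ^ m * measure_pmf.expectation ?M ?g"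
    by (simp only: Bochner_Integration.integral_add[OF integrable_play integrable_play]
        integral_mult_right_zero)
  also have "measure_pmf.expectation ?M (\<lambda>z. total_pay \<Gamma> (tl (fst z))) =
      measure_pmf.expectation (map_pmf (\<lambda>z. tl (fst z)) ?M) (total_pay \<Gamma>)"
    by (simp only: integral_map_pmf)
  also have "\<dots> = payoff \<Gamma> m p q \<sigma> \<tau>"
    unfolding map_tl_play by (simp add: payoff_def)
  finally show ?thesis .
qed

context
  fixes \<Gamma> :: "('k::finite, 'l::finite, 'a::finite, 'b::finite) game" and G :: real
  assumes disc_nonneg: "0 \<le> disc \<Gamma>"
    and pay_nonneg: "\<And>k l a b. 0 \<le> pay \<Gamma> k l a b"
    and pay_le: "\<And>k l a b. pay \<Gamma> k l a b \<le> G"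
begin

text \<open>Under unchanged strategies, going from \<open>m\<close> to \<open>Suc m\<close> stages
  adds \<open>disc \<Gamma> ^ m\<close> times an expected stage payoff, which lies between 0 and
  \<open>G\<close>.\<close>

lemma payoff_tail:
  assumes "n \<le> m"
  shows "payoff \<Gamma> n p q \<sigma> \<tau> \<le> payoff \<Gamma> m p q \<sigma> \<tau> \<and>
    payoff \<Gamma> m p q \<sigma> \<tau> \<le> payoff \<Gamma> n p q \<sigma> \<tau> + (\<Sum>t=n..<m. disc \<Gamma> ^ t) * G"
  using assms
proof (induction m rule: dec_induct)
  case base
  then show ?case by simp
next
  case (step m)
  let ?M = "play \<Gamma> p q \<sigma> \<tau> (Suc m)"
  define g where "g z = (case hd (fst z) of (k, l, a, b) \<Rightarrow> pay \<Gamma> k l a b)"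
    for z :: "('k \<times> 'l \<times> 'a \<times> 'b) list \<times> 'k \<times> 'l"
  have "measure_pmf.expectation ?M g \<le> measure_pmf.expectation ?M (\<lambda>_. G)"
    by (intro integral_mono integrable_play) (auto simp: g_def pay_le split: prod.splits)
  then have "measure_pmf.expectation ?M g \<le> G" by simp
  moreover have "0 \<le> measure_pmf.expectation ?M g"
    by (intro integral_nonneg_AE) (auto simp: g_def pay_nonneg split: prod.splits)
  ultimately have "0 \<le> disc \<Gamma> ^ m * measure_pmf.expectation ?M g"
    "disc \<Gamma> ^ m * measure_pmf.expectation ?M g \<le> disc \<Gamma> ^ m * G"
    using disc_nonneg by (auto intro: mult_left_mono)
  moreover have "payoff \<Gamma> (Suc m) p q \<sigma> \<tau> =
      payoff \<Gamma> m p q \<sigma> \<tau> + disc \<Gamma> ^ m * measure_pmf.expectation ?M g"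
    unfolding payoff_Suc g_def ..
  ultimately show ?case using step by (simp add: algebra_simps)
qed

lemma payoff_bounds:
  "0 \<le> payoff \<Gamma> m p q \<sigma> \<tau>" "payoff \<Gamma> m p q \<sigma> \<tau> \<le> (\<Sum>t=0..<m. disc \<Gamma> ^ t) * G"
proof -
  have "payoff \<Gamma> 0 p q \<sigma> \<tau> = 0"
    by (simp add: payoff_def total_pay_def case_prod_beta)
  then show "0 \<le> payoff \<Gamma> m p q \<sigma> \<tau>" "payoff \<Gamma> m p q \<sigma> \<tau> \<le> (\<Sum>t=0..<m. disc \<Gamma> ^ t) * G"
    using payoff_tail[of 0 m p q \<sigma> \<tau>] by auto
qed

lemma bdd_payoff:
  "bdd_above (range (\<lambda>\<sigma>. payoff \<Gamma> m p q \<sigma> \<tau>))" "bdd_below (range (payoff \<Gamma> m p q \<sigma>))"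
  "bdd_above (range (\<lambda>\<sigma>. INF \<tau>. payoff \<Gamma> m p q \<sigma> \<tau>))"
proof -
  show "bdd_above (range (\<lambda>\<sigma>. payoff \<Gamma> m p q \<sigma> \<tau>))"
    by (rule bdd_aboveI2) (rule payoff_bounds(2))
  show *: "bdd_below (range (payoff \<Gamma> m p q \<sigma>))" for \<sigma>
    by (rule bdd_belowI2) (rule payoff_bounds(1))
  have "(INF \<tau>. payoff \<Gamma> m p q \<sigma> \<tau>) \<le> (\<Sum>t=0..<m. disc \<Gamma> ^ t) * G" for \<sigma>
    by (rule cINF_lower2[OF * _ payoff_bounds(2)]) simp
  then show "bdd_above (range (\<lambda>\<sigma>. INF \<tau>. payoff \<Gamma> m p q \<sigma> \<tau>))"
    by (rule bdd_aboveI2)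
qed

section \<open>Values and worst cases over \<open>n\<close> and \<open>N\<close> stages\<close>

text \<open>The nontrivial direction; the reverse inequality is weak duality.\<close>

lemma primal_minimax: "(INF \<tau>. SUP \<sigma>. payoff \<Gamma> m p q \<sigma> \<tau>) \<le> primal_value \<Gamma> m p q"
proof -
  obtain F where F: "finite F"
    "\<And>\<sigma> \<tau>. \<exists>\<tau>'\<in>F. payoff \<Gamma> m p q \<sigma> \<tau>' \<le> payoff \<Gamma> m p q \<sigma> \<tau>"
    using finite_best_replies[of \<Gamma> m p q] by blast
  show ?thesis
    unfolding primal_value_def game_value_def
    by (rule minimax[OF mixable_payoff1 mixable_payoff2 F payoff_bounds])
qed

text \<open>Later payoffs are nonnegative, so each strategy of player 1 guarantees at least as much
  over the longer horizon.\<close>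

lemma primal_value_mono:
  assumes "n \<le> m"
  shows "primal_value \<Gamma> n p q \<le> primal_value \<Gamma> m p q"
  unfolding primal_value_def game_value_def
proof (rule cSUP_mono)
  fix \<sigma>
  have "(INF \<tau>. payoff \<Gamma> n p q \<sigma> \<tau>) \<le> (INF \<tau>. payoff \<Gamma> m p q \<sigma> \<tau>)"
  proof (rule cINF_mono)
    fix \<tau>
    show "\<exists>\<tau>'\<in>UNIV. payoff \<Gamma> n p q \<sigma> \<tau>' \<le> payoff \<Gamma> m p q \<sigma> \<tau>"
      using payoff_tail[OF assms] by blast
  qed (auto simp: bdd_payoff)
  then show "\<exists>\<sigma>'\<in>UNIV. (INF \<tau>. payoff \<Gamma> n p q \<sigma> \<tau>) \<le> (INF \<tau>. payoff \<Gamma> m p q \<sigma>' \<tau>)" by blast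
qed (auto simp: bdd_payoff)

text \<open>Against any \<open>\<sigma>\<close> the first \<open>n\<close> stages cost at most the
  \<open>n\<close>-stage min-max, because \<open>\<tau>\<close> agrees there with the optimal
  \<open>\<tau>0\<close>; the remaining stages cost at most the tail. The min-max is at most the
  \<open>n\<close>-stage value, and this is at most the \<open>N\<close>-stage value.\<close>

lemma worst_case2_le:
  assumes "n \<le> N" and opt: "optimal_min (payoff \<Gamma> n p q) \<tau>0"
    and \<tau>: "\<And>h l. length h < n \<Longrightarrow> \<tau> h l = \<tau>0 h l"
  shows "worst_case2 \<Gamma> N p q \<tau> \<le> primal_value \<Gamma> N p q + (\<Sum>t=n..<N. disc \<Gamma> ^ t) * G"
  unfolding worst_case2_def
proof (rule cSUP_least)
  fix \<sigma>
  have "payoff \<Gamma> N p q \<sigma> \<tau> \<le> payoff \<Gamma> n p q \<sigma> \<tau> + (\<Sum>t=n..<N. disc \<Gamma> ^ t) * G"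
    using payoff_tail[OF \<open>n \<le> N\<close>] by blast
  moreover have "payoff \<Gamma> n p q \<sigma> \<tau> = payoff \<Gamma> n p q \<sigma> \<tau>0"
    using \<tau> by (intro payoff_cong) auto
  moreover have "payoff \<Gamma> n p q \<sigma> \<tau>0 \<le> (SUP \<sigma>. payoff \<Gamma> n p q \<sigma> \<tau>0)"
    by (intro cSUP_upper bdd_payoff) simp
  moreover have "\<dots> \<le> (INF \<tau>. SUP \<sigma>. payoff \<Gamma> n p q \<sigma> \<tau>)"
    using opt unfolding optimal_min_def by (intro cINF_greatest) auto
  moreover note primal_minimax[of n p q] primal_value_mono[OF \<open>n \<le> N\<close>, of p q]
  ultimately show "payoff \<Gamma> N p q \<sigma> \<tau> \<le> primal_value \<Gamma> N p q + (\<Sum>t=n..<N. disc \<Gamma> ^ t) * G"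
    by linarith
qed simp

text \<open>What any \<open>\<sigma>'\<close> guarantees over \<open>N\<close> stages exceeds its
  \<open>n\<close>-stage guarantee by at most the tail, and the latter is at most the guarantee of
  \<open>\<sigma>0\<close>. Since \<open>\<sigma>\<close> starts like \<open>\<sigma>0\<close>,
  nonnegative later payoffs preserve that guarantee over \<open>N\<close> stages.\<close>

lemma le_worst_case1:
  assumes "n \<le> N" and opt: "optimal_max (payoff \<Gamma> n p q) \<sigma>0"
    and \<sigma>: "\<And>h k. length h < n \<Longrightarrow> \<sigma> h k = \<sigma>0 h k"
  shows "primal_value \<Gamma> N p q \<le> worst_case1 \<Gamma> N p q \<sigma> + (\<Sum>t=n..<N. disc \<Gamma> ^ t) * G"
proof -
  let ?T = "(\<Sum>t=n..<N. disc \<Gamma> ^ t) * G"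
  have *: "(INF \<tau>. payoff \<Gamma> n p q \<sigma>0 \<tau>) \<le> worst_case1 \<Gamma> N p q \<sigma>"
    unfolding worst_case1_def
  proof (rule cINF_mono)
    fix \<tau>
    have "payoff \<Gamma> n p q \<sigma>0 \<tau> = payoff \<Gamma> n p q \<sigma> \<tau>" using \<sigma> by (intro payoff_cong) auto
    also have "\<dots> \<le> payoff \<Gamma> N p q \<sigma> \<tau>" using payoff_tail[OF \<open>n \<le> N\<close>] by blast
    finally show "\<exists>\<tau>'\<in>UNIV. payoff \<Gamma> n p q \<sigma>0 \<tau>' \<le> payoff \<Gamma> N p q \<sigma> \<tau>" by blast
  qed (auto simp: bdd_payoff)
  show ?thesis
    unfolding primal_value_def game_value_def
  proof (rule cSUP_least)
    fix \<sigma>'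
    have "(INF \<tau>. payoff \<Gamma> N p q \<sigma>' \<tau>) - ?T \<le> (INF \<tau>. payoff \<Gamma> n p q \<sigma>' \<tau>)"
    proof (rule cINF_greatest)
      fix \<tau>
      have "(INF \<tau>. payoff \<Gamma> N p q \<sigma>' \<tau>) \<le> payoff \<Gamma> N p q \<sigma>' \<tau>"
        by (intro cINF_lower bdd_payoff) simp
      also have "\<dots> \<le> payoff \<Gamma> n p q \<sigma>' \<tau> + ?T" using payoff_tail[OF \<open>n \<le> N\<close>] by blast
      finally show "(INF \<tau>. payoff \<Gamma> N p q \<sigma>' \<tau>) - ?T \<le> payoff \<Gamma> n p q \<sigma>' \<tau>" by simp
    qed simp
    also have "\<dots> \<le> (INF \<tau>. payoff \<Gamma> n p q \<sigma>0 \<tau>)" using opt unfolding optimal_max_def by blast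
    finally show "(INF \<tau>. payoff \<Gamma> N p q \<sigma>' \<tau>) \<le> worst_case1 \<Gamma> N p q \<sigma> + ?T" using * by linarith
  qed simp
qed

end

section \<open>The geometric tail and the two bounds\<close>

lemma sum_disc_powers:
  fixes x :: real
  assumes "n < N"
  shows "(\<Sum>t=n..<N. x ^ t) = x ^ n * (if x = 1 then real (N - n) else (1 - x ^ (N - n)) / (1 - x))"
proof -
  have "(\<Sum>t=n..<N. x ^ t) = (\<Sum>t<N - n. x ^ (t + n))"
    using sum.shift_bounds_nat_ivl[of "\<lambda>t. x ^ t" 0 n "N - n"] assms by (simp add: atLeast0LessThan)
  also have "\<dots> = x ^ n * (\<Sum>t<N - n. x ^ t)" by (simp add: power_add sum_distrib_left mult.commute)
  finally show ?thesis by (simp add: sum_gp_strict)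
qed

theorem theorem3:
  fixes \<Gamma> :: "('k::finite, 'l::finite, 'a::finite, 'b::finite) game"
    and p :: "'k pmf" and q :: "'l pmf" and n N :: nat and Gbar :: real
  assumes "1 \<le> n" and "n < N"
    and "0 < disc \<Gamma>" and "disc \<Gamma> \<le> 1"
    and "\<forall>k l a b. 0 \<le> pay \<Gamma> k l a b"
    and "Gbar = Max (range (\<lambda>(k, l, a, b). pay \<Gamma> k l a b))"
  shows "(\<forall>\<tau>. window_strategy2 \<Gamma> n N p q \<tau> \<longrightarrow>
            worst_case2 \<Gamma> N p q \<tau> - primal_value \<Gamma> N p q
              \<le> disc \<Gamma> ^ n *
                 (if disc \<Gamma> = 1 then real (N - n)
                  else (1 - disc \<Gamma> ^ (N - n)) / (1 - disc \<Gamma>)) * Gbar) \<and>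
         (\<forall>\<sigma>. window_strategy1 \<Gamma> n N p q \<sigma> \<longrightarrow>
            primal_value \<Gamma> N p q - worst_case1 \<Gamma> N p q \<sigma>
              \<le> disc \<Gamma> ^ n *
                 (if disc \<Gamma> = 1 then real (N - n)
                  else (1 - disc \<Gamma> ^ (N - n)) / (1 - disc \<Gamma>)) * Gbar)"
proof -
  have G: "pay \<Gamma> k l a b \<le> Gbar" for k l a b
    unfolding assms(6) by (rule Max_ge) (auto intro!: image_eqI[of _ _ "(k, l, a, b)"])
  have "0 \<le> disc \<Gamma>" "\<And>k l a b. 0 \<le> pay \<Gamma> k l a b" "n \<le> N"
    using assms by auto
  note bounds = worst_case2_le[OF this(1,2) G this(3)] le_worst_case1[OF this(1,2) G this(3)]
  show ?thesis
    \<comment> \<open>Folds the closed form, with its separate case for discount 1, back into the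
      tail sum that occurs in \<open>bounds\<close>.\<close>
    unfolding sum_disc_powers[OF \<open>n < N\<close>, symmetric]
  proof (intro conjI allI impI)
    fix \<tau> assume "window_strategy2 \<Gamma> n N p q \<tau>"
    then obtain \<tau>0 where "optimal_min (payoff \<Gamma> n p q) \<tau>0"
      "\<And>h l. length h < n \<Longrightarrow> \<tau> h l = \<tau>0 h l"
      unfolding window_strategy2_def by blast
    from bounds(1)[OF this] show "worst_case2 \<Gamma> N p q \<tau> - primal_value \<Gamma> N p q \<le> (\<Sum>t=n..<N. disc \<Gamma> ^ t) * Gbar"
      by simp
  next
    fix \<sigma> assume "window_strategy1 \<Gamma> n N p q \<sigma>"
    then obtain \<sigma>0 where "optimal_max (payoff \<Gamma> n p q) \<sigma>0"
      "\<And>h k. length h < n \<Longrightarrow> \<sigma> h k = \<sigma>0 h k"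
      unfolding window_strategy1_def by blast
    from bounds(2)[OF this] show "primal_value \<Gamma> N p q - worst_case1 \<Gamma> N p q \<sigma> \<le> (\<Sum>t=n..<N. disc \<Gamma> ^ t) * Gbar"
      by simp
  qed
qed

end
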